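(* Let $K$ be a field, $\Gamma$ a finite graph, $L_\Gamma$ the associated right angled Artin Lie algebra over $K$, and $\chi: L_\Gamma/[L_\Gamma,L_\Gamma]\to K$ a non-zero $K$-linear map. Then the ideal $I_\chi$ of $L_\Gamma$ is finitely generated as a Lie algebra if and only if $\Gamma_\chi$ is connected and dominant in $\Gamma$. In this case $I_\chi$ is generated as a Lie algebra by $\ker(\chi)$.
   Context: Graphs have no loops and no multiple edges. For a finite graph $\Gamma$ with vertex set $V(\Gamma)$, $L_\Gamma$ is the Lie algebra over $K$ with generators $V(\Gamma)$ and relations $[v,w]=0$ whenever $v,w$ are joined by an edge (it is isomorphic to $\mathrm{gr}(G_\Gamma)\otimes_{\mathbb Z}K$, where $G_\Gamma$ is the right angled Artin group of $\Gamma$). The abelianization $L_\Gamma/[L_\Gamma,L_\Gamma]$ is identified with the $K$-linear span $V$ of $V(\Gamma)$ in $L_\Gamma$, which has basis $V(\Gamma)$; via this identification $\ker(\chi)$ is regarded as a subspace of $L_\Gamma$. Let $\pi:L_\Gamma\to L_\Gamma/[L_\Gamma,L_\Gamma]$ be the projection; $I_\chi=\pi^{-1}(\ker\chi)$. $\Gamma_\chi$ is the full subgraph of $\Gamma$ spanned by the vertices $v$ with $\chi(v)\neq 0$. A subgraph $\Gamma_1$ of $\Gamma$ is dominant in $\Gamma$ if for every $v\in V(\Gamma)\setminus V(\Gamma_1)$ there is $w\in V(\Gamma_1)$ linked with $v$ by an edge of $\Gamma$. *)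

theory Defs
  imports "Graph_Theory.Graph_Theory" "HOL-Algebra.Module" "HOL-Algebra.AbelCoset"
begin

text \<open>
  A Lie algebra extends the \<open>module\<close> record by a bracket. The fields \<open>mult\<close> and \<open>one\<close> that
  \<open>module\<close> inherits from \<open>ring\<close> carry no meaning here.
\<close>

record ('k, 'l) lie_algebra = "('k, 'l) module" +
  lie_bracket :: "'l \<Rightarrow> 'l \<Rightarrow> 'l"

locale lie_algebra = Ring.field K + Module.module K L
  for K :: "('k, 'm) ring_scheme" (structure) and L :: "('k, 'l, 'n) lie_algebra_scheme" (structure) +
  assumes bracket_closed:
      "\<lbrakk>x \<in> carrier L; y \<in> carrier L\<rbrakk> \<Longrightarrow> lie_bracket L x y \<in> carrier L"
    and bracket_add_left:
      "\<lbrakk>x \<in> carrier L; y \<in> carrier L; z \<in> carrier L\<rbrakk> \<Longrightarrow>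
        lie_bracket L (x \<oplus>\<^bsub>L\<^esub> y) z = lie_bracket L x z \<oplus>\<^bsub>L\<^esub> lie_bracket L y z"
    and bracket_add_right:
      "\<lbrakk>x \<in> carrier L; y \<in> carrier L; z \<in> carrier L\<rbrakk> \<Longrightarrow>
        lie_bracket L x (y \<oplus>\<^bsub>L\<^esub> z) = lie_bracket L x y \<oplus>\<^bsub>L\<^esub> lie_bracket L x z"
    and bracket_smult_left:
      "\<lbrakk>a \<in> carrier K; x \<in> carrier L; y \<in> carrier L\<rbrakk> \<Longrightarrow>
        lie_bracket L (a \<odot>\<^bsub>L\<^esub> x) y = a \<odot>\<^bsub>L\<^esub> lie_bracket L x y"
    and bracket_smult_right:
      "\<lbrakk>a \<in> carrier K; x \<in> carrier L; y \<in> carrier L\<rbrakk> \<Longrightarrow>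
        lie_bracket L x (a \<odot>\<^bsub>L\<^esub> y) = a \<odot>\<^bsub>L\<^esub> lie_bracket L x y"
    and bracket_alternating:
      "x \<in> carrier L \<Longrightarrow> lie_bracket L x x = \<zero>\<^bsub>L\<^esub>"
    and jacobi:
      "\<lbrakk>x \<in> carrier L; y \<in> carrier L; z \<in> carrier L\<rbrakk> \<Longrightarrow>
        lie_bracket L x (lie_bracket L y z) \<oplus>\<^bsub>L\<^esub> lie_bracket L y (lie_bracket L z x)
          \<oplus>\<^bsub>L\<^esub> lie_bracket L z (lie_bracket L x y) = \<zero>\<^bsub>L\<^esub>"

definition lie_subalgebra ::
    "('k, 'm) ring_scheme \<Rightarrow> ('k, 'l, 'n) lie_algebra_scheme \<Rightarrow> 'l set \<Rightarrow> bool" where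
  "lie_subalgebra K L H \<longleftrightarrow>
     submodule H K L \<and> (\<forall>x\<in>H. \<forall>y\<in>H. lie_bracket L x y \<in> H)"

definition lie_generated ::
    "('k, 'm) ring_scheme \<Rightarrow> ('k, 'l, 'n) lie_algebra_scheme \<Rightarrow> 'l set \<Rightarrow> 'l set" where
  "lie_generated K L S = \<Inter>{H. lie_subalgebra K L H \<and> S \<subseteq> H}"

definition fin_gen_lie ::
    "('k, 'm) ring_scheme \<Rightarrow> ('k, 'l, 'n) lie_algebra_scheme \<Rightarrow> 'l set \<Rightarrow> bool" where
  "fin_gen_lie K L H \<longleftrightarrow> (\<exists>S. finite S \<and> S \<subseteq> H \<and> lie_generated K L S = H)"

definition lin_span ::
    "('k, 'm) ring_scheme \<Rightarrow> ('k, 'l, 'n) module_scheme \<Rightarrow> 'l set \<Rightarrow> 'l set" where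
  "lin_span K M S = \<Inter>{N. submodule N K M \<and> S \<subseteq> N}"

definition quot_module ::
    "('k, 'l, 'n) module_scheme \<Rightarrow> 'l set \<Rightarrow> ('k, 'l set) module" where
  "quot_module M N =
     \<lparr>carrier = a_rcosets\<^bsub>M\<^esub> N, mult = undefined, one = undefined, zero = N, add = set_add M,
      smult = (\<lambda>a X. \<Union>x\<in>X. N +>\<^bsub>M\<^esub> (a \<odot>\<^bsub>M\<^esub> x))\<rparr>"

definition linear_form ::
    "('k, 'm) ring_scheme \<Rightarrow> ('k, 'l, 'n) module_scheme \<Rightarrow> ('l \<Rightarrow> 'k) \<Rightarrow> bool" where
  "linear_form K M f \<longleftrightarrow>
     f \<in> hom (add_monoid M) (add_monoid K) \<and>
     (\<forall>a\<in>carrier K. \<forall>x\<in>carrier M. f (a \<odot>\<^bsub>M\<^esub> x) = a \<otimes>\<^bsub>K\<^esub> f x)"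

definition derived_subspace ::
    "('k, 'm) ring_scheme \<Rightarrow> ('k, 'l, 'n) lie_algebra_scheme \<Rightarrow> 'l set" where
  "derived_subspace K L =
     lin_span K L {lie_bracket L x y | x y. x \<in> carrier L \<and> y \<in> carrier L}"

definition abelianization ::
    "('k, 'm) ring_scheme \<Rightarrow> ('k, 'l, 'n) lie_algebra_scheme \<Rightarrow> ('k, 'l set) module" where
  "abelianization K L = quot_module L (derived_subspace K L)"

definition ab_proj ::
    "('k, 'm) ring_scheme \<Rightarrow> ('k, 'l, 'n) lie_algebra_scheme \<Rightarrow> 'l \<Rightarrow> 'l set" where
  "ab_proj K L x = derived_subspace K L +>\<^bsub>L\<^esub> x"

definition char_ideal ::
    "('k, 'm) ring_scheme \<Rightarrow> ('k, 'l, 'n) lie_algebra_scheme \<Rightarrow> ('l set \<Rightarrow> 'k) \<Rightarrow> 'l set" where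
  "char_ideal K L \<chi> = {x \<in> carrier L. ab_proj K L x \<in> a_kernel (abelianization K L) K \<chi>}"


text \<open>
  The Lie algebra presented by generators \<open>X\<close> and relators \<open>R\<close> consists of the formal Lie
  expressions in \<open>X\<close> modulo the smallest congruence \<open>lie_eq K X R\<close> that satisfies the Lie algebra
  axioms and makes every element of \<open>R\<close> zero.
\<close>

datatype ('k, 'v) lie_term =
    Gen 'v
  | Zero
  | Add "('k, 'v) lie_term" "('k, 'v) lie_term"
  | Smult 'k "('k, 'v) lie_term"
  | Bracket "('k, 'v) lie_term" "('k, 'v) lie_term"

inductive_set lie_terms :: "('k, 'm) ring_scheme \<Rightarrow> 'v set \<Rightarrow> ('k, 'v) lie_term set"
  for K :: "('k, 'm) ring_scheme" and X :: "'v set" where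
  gen: "v \<in> X \<Longrightarrow> Gen v \<in> lie_terms K X"
| zero: "Zero \<in> lie_terms K X"
| add: "\<lbrakk>s \<in> lie_terms K X; t \<in> lie_terms K X\<rbrakk> \<Longrightarrow> Add s t \<in> lie_terms K X"
| smult: "\<lbrakk>a \<in> carrier K; s \<in> lie_terms K X\<rbrakk> \<Longrightarrow> Smult a s \<in> lie_terms K X"
| bracket: "\<lbrakk>s \<in> lie_terms K X; t \<in> lie_terms K X\<rbrakk> \<Longrightarrow> Bracket s t \<in> lie_terms K X"

inductive_set lie_eq ::
    "('k, 'm) ring_scheme \<Rightarrow> 'v set \<Rightarrow> ('k, 'v) lie_term set \<Rightarrow>
      (('k, 'v) lie_term \<times> ('k, 'v) lie_term) set"
  for K :: "('k, 'm) ring_scheme" (structure) and X :: "'v set" and R :: "('k, 'v) lie_term set"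
where
  refl: "s \<in> lie_terms K X \<Longrightarrow> (s, s) \<in> lie_eq K X R"
| sym: "(s, t) \<in> lie_eq K X R \<Longrightarrow> (t, s) \<in> lie_eq K X R"
| trans: "\<lbrakk>(s, t) \<in> lie_eq K X R; (t, u) \<in> lie_eq K X R\<rbrakk> \<Longrightarrow> (s, u) \<in> lie_eq K X R"
| cong_add: "\<lbrakk>(s, s') \<in> lie_eq K X R; (t, t') \<in> lie_eq K X R\<rbrakk> \<Longrightarrow>
    (Add s t, Add s' t') \<in> lie_eq K X R"
| cong_smult: "\<lbrakk>a \<in> carrier K; (s, s') \<in> lie_eq K X R\<rbrakk> \<Longrightarrow>
    (Smult a s, Smult a s') \<in> lie_eq K X R"
| cong_bracket: "\<lbrakk>(s, s') \<in> lie_eq K X R; (t, t') \<in> lie_eq K X R\<rbrakk> \<Longrightarrow>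
    (Bracket s t, Bracket s' t') \<in> lie_eq K X R"
| add_assoc: "\<lbrakk>s \<in> lie_terms K X; t \<in> lie_terms K X; u \<in> lie_terms K X\<rbrakk> \<Longrightarrow>
    (Add (Add s t) u, Add s (Add t u)) \<in> lie_eq K X R"
| add_comm: "\<lbrakk>s \<in> lie_terms K X; t \<in> lie_terms K X\<rbrakk> \<Longrightarrow>
    (Add s t, Add t s) \<in> lie_eq K X R"
| add_zero: "s \<in> lie_terms K X \<Longrightarrow> (Add Zero s, s) \<in> lie_eq K X R"
| add_neg: "s \<in> lie_terms K X \<Longrightarrow> (Add (Smult (\<ominus> \<one>) s) s, Zero) \<in> lie_eq K X R"
| smult_add_scalar: "\<lbrakk>a \<in> carrier K; b \<in> carrier K; s \<in> lie_terms K X\<rbrakk> \<Longrightarrow>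
    (Smult (a \<oplus> b) s, Add (Smult a s) (Smult b s)) \<in> lie_eq K X R"
| smult_add: "\<lbrakk>a \<in> carrier K; s \<in> lie_terms K X; t \<in> lie_terms K X\<rbrakk> \<Longrightarrow>
    (Smult a (Add s t), Add (Smult a s) (Smult a t)) \<in> lie_eq K X R"
| smult_assoc: "\<lbrakk>a \<in> carrier K; b \<in> carrier K; s \<in> lie_terms K X\<rbrakk> \<Longrightarrow>
    (Smult (a \<otimes> b) s, Smult a (Smult b s)) \<in> lie_eq K X R"
| smult_one: "s \<in> lie_terms K X \<Longrightarrow> (Smult \<one> s, s) \<in> lie_eq K X R"
| bracket_add_left: "\<lbrakk>s \<in> lie_terms K X; t \<in> lie_terms K X; u \<in> lie_terms K X\<rbrakk> \<Longrightarrow>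
    (Bracket (Add s t) u, Add (Bracket s u) (Bracket t u)) \<in> lie_eq K X R"
| bracket_add_right: "\<lbrakk>s \<in> lie_terms K X; t \<in> lie_terms K X; u \<in> lie_terms K X\<rbrakk> \<Longrightarrow>
    (Bracket s (Add t u), Add (Bracket s t) (Bracket s u)) \<in> lie_eq K X R"
| bracket_smult_left: "\<lbrakk>a \<in> carrier K; s \<in> lie_terms K X; t \<in> lie_terms K X\<rbrakk> \<Longrightarrow>
    (Bracket (Smult a s) t, Smult a (Bracket s t)) \<in> lie_eq K X R"
| bracket_smult_right: "\<lbrakk>a \<in> carrier K; s \<in> lie_terms K X; t \<in> lie_terms K X\<rbrakk> \<Longrightarrow>
    (Bracket s (Smult a t), Smult a (Bracket s t)) \<in> lie_eq K X R"
| bracket_alternating: "s \<in> lie_terms K X \<Longrightarrow> (Bracket s s, Zero) \<in> lie_eq K X R"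
| jacobi: "\<lbrakk>s \<in> lie_terms K X; t \<in> lie_terms K X; u \<in> lie_terms K X\<rbrakk> \<Longrightarrow>
    (Add (Add (Bracket s (Bracket t u)) (Bracket t (Bracket u s))) (Bracket u (Bracket s t)), Zero)
      \<in> lie_eq K X R"
| relator: "\<lbrakk>r \<in> R; r \<in> lie_terms K X\<rbrakk> \<Longrightarrow> (r, Zero) \<in> lie_eq K X R"

definition presented_lie ::
    "('k, 'm) ring_scheme \<Rightarrow> 'v set \<Rightarrow> ('k, 'v) lie_term set \<Rightarrow>
      ('k, ('k, 'v) lie_term set) lie_algebra" where
  "presented_lie K X R =
     \<lparr>carrier = lie_terms K X // lie_eq K X R, mult = undefined, one = undefined,
      zero = lie_eq K X R `` {Zero},
      add = (\<lambda>P Q. \<Union>s\<in>P. \<Union>t\<in>Q. lie_eq K X R `` {Add s t}),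
      smult = (\<lambda>a P. \<Union>s\<in>P. lie_eq K X R `` {Smult a s}),
      lie_bracket = (\<lambda>P Q. \<Union>s\<in>P. \<Union>t\<in>Q. lie_eq K X R `` {Bracket s t})\<rparr>"

lemma lie_eq_terms:
  assumes "cring K" "(s, t) \<in> lie_eq K X R"
  shows "s \<in> lie_terms K X \<and> t \<in> lie_terms K X"
proof -
  interpret cring K by fact
  show ?thesis using assms(2)
    by induction (auto intro!: lie_terms.intros)
qed

lemma equiv_lie_eq:
  assumes "cring K"
  shows "equiv (lie_terms K X) (lie_eq K X R)"
  using lie_eq_terms[OF assms] by (auto intro!: equivI refl_onI symI transI intro: lie_eq.intros)

lemma presented_lie_algebra:
  assumes "Ring.field K"
  shows "lie_algebra K (presented_lie K X R)"
proof -
  interpret K: Ring.field K by fact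
  let ?T = "lie_terms K X" and ?E = "lie_eq K X R" and ?L = "presented_lie K X R"
  note E = equiv_lie_eq[OF K.is_cring, of X R]
  define c where "c s = ?E `` {s}" for s
  have ex: "\<exists>s\<in>?T. P = c s" if "P \<in> carrier ?L" for P
    using that by (auto simp: presented_lie_def c_def elim!: quotientE)
  have cc: "c s \<in> carrier ?L" if "s \<in> ?T" for s
    using that by (auto simp: presented_lie_def c_def intro: quotientI)
  have ceq: "c s = c t" if "(s, t) \<in> ?E" for s t
    unfolding c_def using equiv_class_eq[OF E that] .
  have self: "s \<in> c s" if "s \<in> ?T" for s
    using that by (simp add: c_def lie_eq.refl)
  have mem: "(s, s') \<in> ?E" if "s' \<in> c s" for s s'
    using that by (simp add: c_def)
  have lift2: "(\<Union>s'\<in>c s. \<Union>t'\<in>c t. c (f s' t')) = c (f s t)"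
    if s: "s \<in> ?T" "t \<in> ?T"
      and f: "\<And>s' t'. (s, s') \<in> ?E \<Longrightarrow> (t, t') \<in> ?E \<Longrightarrow> (f s t, f s' t') \<in> ?E" for s t f
  proof -
    have "c (f s' t') = c (f s t)" if "s' \<in> c s" "t' \<in> c t" for s' t'
      using that f ceq mem by metis
    then show ?thesis using self s by blast
  qed
  have lift1: "(\<Union>s'\<in>c s. c (f s')) = c (f s)"
    if s: "s \<in> ?T" and f: "\<And>s'. (s, s') \<in> ?E \<Longrightarrow> (f s, f s') \<in> ?E" for s f
  proof -
    have "c (f s') = c (f s)" if "s' \<in> c s" for s'
      using that f ceq mem by metis
    then show ?thesis using self s by blast
  qed
  have add: "c s \<oplus>\<^bsub>?L\<^esub> c t = c (Add s t)" if "s \<in> ?T" "t \<in> ?T" for s t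
    using lift2[OF that, of Add] by (simp add: presented_lie_def c_def lie_eq.cong_add)
  have smult: "a \<odot>\<^bsub>?L\<^esub> c s = c (Smult a s)" if "a \<in> carrier K" "s \<in> ?T" for a s
    using lift1[OF that(2), of "Smult a"] that(1)
    by (simp add: presented_lie_def c_def lie_eq.cong_smult)
  have bracket: "lie_bracket ?L (c s) (c t) = c (Bracket s t)" if "s \<in> ?T" "t \<in> ?T" for s t
    using lift2[OF that, of Bracket] by (simp add: presented_lie_def c_def lie_eq.cong_bracket)
  have zero: "\<zero>\<^bsub>?L\<^esub> = c Zero"
    by (simp add: presented_lie_def c_def)
  note T = lie_terms.intros
  note ops = add smult bracket zero T
  have ab: "abelian_group ?L"
  proof (rule abelian_groupI)
    show "\<zero>\<^bsub>?L\<^esub> \<in> carrier ?L" by (simp add: ops cc)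
    fix P assume P: "P \<in> carrier ?L"
    then obtain s where s: "s \<in> ?T" "P = c s" using ex by blast
    show "\<zero>\<^bsub>?L\<^esub> \<oplus>\<^bsub>?L\<^esub> P = P" using s by (simp add: ops ceq lie_eq.add_zero)
    show "\<exists>Q\<in>carrier ?L. Q \<oplus>\<^bsub>?L\<^esub> P = \<zero>\<^bsub>?L\<^esub>"
      using s by (intro bexI[of _ "c (Smult (\<ominus>\<^bsub>K\<^esub> \<one>\<^bsub>K\<^esub>) s)"]) (simp_all add: ops cc ceq lie_eq.add_neg)
    fix Q assume "Q \<in> carrier ?L"
    then obtain t where t: "t \<in> ?T" "Q = c t" using ex by blast
    show "P \<oplus>\<^bsub>?L\<^esub> Q \<in> carrier ?L" using s t by (simp add: ops cc)
    show "P \<oplus>\<^bsub>?L\<^esub> Q = Q \<oplus>\<^bsub>?L\<^esub> P" using s t by (simp add: ops ceq lie_eq.add_comm)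
    fix U assume "U \<in> carrier ?L"
    then obtain u where u: "u \<in> ?T" "U = c u" using ex by blast
    show "P \<oplus>\<^bsub>?L\<^esub> Q \<oplus>\<^bsub>?L\<^esub> U = P \<oplus>\<^bsub>?L\<^esub> (Q \<oplus>\<^bsub>?L\<^esub> U)"
      using s t u by (simp add: ops ceq lie_eq.add_assoc)
  qed
  have mod: "Module.module K ?L"
    by (rule moduleI[OF K.is_cring ab])
       (auto dest!: ex simp: ops cc del: equalityI intro!: ceq lie_eq.smult_add_scalar
          lie_eq.smult_add lie_eq.smult_assoc lie_eq.smult_one)
  show ?thesis
    apply (rule lie_algebra.intro[OF assms mod])
    apply unfold_locales
    by (auto dest!: ex simp: ops cc del: equalityI intro!: ceq lie_eq.bracket_add_left lie_eq.bracket_add_right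
          lie_eq.bracket_smult_left lie_eq.bracket_smult_right lie_eq.bracket_alternating
          lie_eq.jacobi)
qed

lemma presented_relator:
  assumes "Ring.field K" "r \<in> R" "r \<in> lie_terms K X"
  shows "lie_eq K X R `` {r} = \<zero>\<^bsub>presented_lie K X R\<^esub>"
proof -
  interpret Ring.field K by fact
  show ?thesis
    using equiv_class_eq[OF equiv_lie_eq[OF is_cring] lie_eq.relator[OF assms(2,3)]]
    by (simp add: presented_lie_def)
qed


text \<open>
  Finite simple graphs are the library's \<open>graph\<close>s: finite symmetric digraphs without loops and
  multiple arcs, an undirected edge being a pair of opposite arcs.
\<close>

definition raag_relators :: "('v, 'e) pre_digraph \<Rightarrow> ('k, 'v) lie_term set" where
  "raag_relators \<Gamma> = {Bracket (Gen v) (Gen w) | v w. v \<rightarrow>\<^bsub>\<Gamma>\<^esub> w}"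

definition raag_lie ::
    "('k, 'm) ring_scheme \<Rightarrow> ('v, 'e) pre_digraph \<Rightarrow>
      ('k, ('k, 'v) lie_term set) lie_algebra" where
  "raag_lie K \<Gamma> = presented_lie K (verts \<Gamma>) (raag_relators \<Gamma>)"

definition raag_gen ::
    "('k, 'm) ring_scheme \<Rightarrow> ('v, 'e) pre_digraph \<Rightarrow> 'v \<Rightarrow> ('k, 'v) lie_term set" where
  "raag_gen K \<Gamma> v = lie_eq K (verts \<Gamma>) (raag_relators \<Gamma>) `` {Gen v}"

definition raag_span ::
    "('k, 'm) ring_scheme \<Rightarrow> ('v, 'e) pre_digraph \<Rightarrow> ('k, 'v) lie_term set set" where
  "raag_span K \<Gamma> = lin_span K (raag_lie K \<Gamma>) (raag_gen K \<Gamma> ` verts \<Gamma>)"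

text \<open>
  The projection onto the abelianization restricts to an isomorphism on \<open>raag_span K \<Gamma>\<close>;
  the following set is the preimage of the kernel of \<open>\<chi>\<close> under this isomorphism.
\<close>

definition raag_ker ::
    "('k, 'm) ring_scheme \<Rightarrow> ('v, 'e) pre_digraph \<Rightarrow> (('k, 'v) lie_term set set \<Rightarrow> 'k) \<Rightarrow>
      ('k, 'v) lie_term set set" where
  "raag_ker K \<Gamma> \<chi> =
     {x \<in> raag_span K \<Gamma>.
        ab_proj K (raag_lie K \<Gamma>) x \<in> a_kernel (abelianization K (raag_lie K \<Gamma>)) K \<chi>}"

definition char_subgraph ::
    "('k, 'm) ring_scheme \<Rightarrow> ('v, 'e) pre_digraph \<Rightarrow> (('k, 'v) lie_term set set \<Rightarrow> 'k) \<Rightarrow>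
      ('v, 'e) pre_digraph" where
  "char_subgraph K \<Gamma> \<chi> =
     \<Gamma> \<restriction> {v \<in> verts \<Gamma>. \<chi> (ab_proj K (raag_lie K \<Gamma>) (raag_gen K \<Gamma> v)) \<noteq> \<zero>\<^bsub>K\<^esub>}"

definition dominant_in :: "('v, 'e) pre_digraph \<Rightarrow> ('v, 'e) pre_digraph \<Rightarrow> bool" where
  "dominant_in \<Gamma>\<^sub>1 \<Gamma> \<longleftrightarrow> (\<forall>v \<in> verts \<Gamma> - verts \<Gamma>\<^sub>1. \<exists>w \<in> verts \<Gamma>\<^sub>1. v \<rightarrow>\<^bsub>\<Gamma>\<^esub> w)"

end

theory Submission
  imports Defs
begin

text \<open>
  Let \<open>f\<close> be the composition of \<open>\<chi>\<close> with the projection, so that \<open>I\<^sub>\<chi>\<close> is the kernel of \<open>f\<close>.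

  If \<open>f t = 1\<close>, then \<open>L\<close> is spanned by \<open>I\<^sub>\<chi>\<close> and \<open>t\<close>, and \<open>I\<^sub>\<chi>\<close> contains the elements
  \<open>v - f(v) t\<close>, where \<open>v\<close> is a vertex. The subalgebra \<open>H\<close> that they generate is all of \<open>I\<^sub>\<chi>\<close> as soon
  as it is stable under \<open>ad t\<close>, i.e. contains \<open>[t, v]\<close> for all vertices \<open>v\<close>. For \<open>t\<close> a multiple of a
  vertex of \<open>\<Gamma>\<^sub>\<chi>\<close>, this property spreads from a vertex of \<open>\<Gamma>\<^sub>\<chi>\<close> to its neighbours in \<open>\<Gamma>\<close>.

  Conversely, let \<open>p\<close> be a function on the vertices that is not a multiple of \<open>f\<close> but satisfies
  \<open>f(v) p(w) = f(w) p(v)\<close> on edges. Then \<open>v \<mapsto> (f(v), p(v))\<close> extends to a homomorphism from \<open>L\<close> to a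
  metabelian Lie algebra on \<open>K \<times> K[x]\<close> that maps \<open>I\<^sub>\<chi>\<close> onto a subspace of the abelian part \<open>K[x]\<close>
  with polynomials of all degrees, so \<open>I\<^sub>\<chi>\<close> is not finitely generated. If \<open>\<Gamma>\<^sub>\<chi>\<close> is disconnected,
  let \<open>p\<close> agree with \<open>f\<close> on one component of \<open>\<Gamma>\<^sub>\<chi>\<close> and vanish elsewhere; if \<open>\<Gamma>\<^sub>\<chi>\<close> is not dominant,
  let \<open>p\<close> be the indicator of a vertex without neighbours in \<open>\<Gamma>\<^sub>\<chi>\<close>.
\<close>

section \<open>Generated subalgebras, submodules and linear spans\<close>

lemma lie_generated_subset:
  "lie_subalgebra K L H \<Longrightarrow> S \<subseteq> H \<Longrightarrow> lie_generated K L S \<subseteq> H"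
  by (auto simp: lie_generated_def)

lemma subset_lie_generated: "S \<subseteq> lie_generated K L S"
  by (auto simp: lie_generated_def)

lemma lie_generated_mono: "S \<subseteq> T \<Longrightarrow> lie_generated K L S \<subseteq> lie_generated K L T"
  by (auto simp: lie_generated_def)

lemma subset_lin_span: "S \<subseteq> lin_span K M S"
  by (auto simp: lin_span_def)

context Module.module
begin

lemma minus_zero_module: "\<ominus>\<^bsub>M\<^esub> \<zero>\<^bsub>M\<^esub> = \<zero>\<^bsub>M\<^esub>"
  by (rule M.minus_equality) simp_all

lemma submodule_Inter:
  assumes "\<And>N. N \<in> F \<Longrightarrow> submodule N R M" "F \<noteq> {}"
  shows "submodule (\<Inter>F) R M"
proof (rule submoduleI)
  obtain N where "N \<in> F" using assms(2) by blast
  then show "\<Inter>F \<subseteq> carrier M"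
    using submoduleE(1)[OF assms(1)] by blast
  show "\<zero>\<^bsub>M\<^esub> \<in> \<Inter>F"
    using subgroup.one_closed[OF submodule.axioms(1)[OF assms(1)]] by auto
  show "\<ominus>\<^bsub>M\<^esub> x \<in> \<Inter>F" if "x \<in> \<Inter>F" for x
    using that submoduleE(3)[OF assms(1)] by auto
  show "x \<oplus>\<^bsub>M\<^esub> y \<in> \<Inter>F" if "x \<in> \<Inter>F" "y \<in> \<Inter>F" for x y
    using that submoduleE(5)[OF assms(1)] by auto
  show "a \<odot>\<^bsub>M\<^esub> x \<in> \<Inter>F" if "a \<in> carrier R" "x \<in> \<Inter>F" for a x
    using that submoduleE(4)[OF assms(1)] by auto
qed

lemma lin_span_submodule: "S \<subseteq> carrier M \<Longrightarrow> submodule (lin_span R M S) R M"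
  unfolding lin_span_def by (rule submodule_Inter) (use carrier_is_submodule in auto)

end

section \<open>Subalgebras and bracket identities\<close>

context lie_algebra
begin

lemma lie_subalgebraI:
  assumes "H \<subseteq> carrier L" "\<zero>\<^bsub>L\<^esub> \<in> H"
    and "\<And>x y. x \<in> H \<Longrightarrow> y \<in> H \<Longrightarrow> x \<oplus>\<^bsub>L\<^esub> y \<in> H"
    and smult: "\<And>a x. a \<in> carrier K \<Longrightarrow> x \<in> H \<Longrightarrow> a \<odot>\<^bsub>L\<^esub> x \<in> H"
    and "\<And>x y. x \<in> H \<Longrightarrow> y \<in> H \<Longrightarrow> lie_bracket L x y \<in> H"
  shows "lie_subalgebra K L H"
proof -
  have "\<ominus>\<^bsub>L\<^esub> x \<in> H" if "x \<in> H" for x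
    using smult[of "\<ominus> \<one>" x] that assms(1) by (auto simp: smult_l_minus)
  then show ?thesis
    unfolding lie_subalgebra_def by (intro conjI submoduleI) (use assms in auto)
qed

lemma lie_subalgebraD:
  assumes "lie_subalgebra K L H"
  shows "H \<subseteq> carrier L" "\<zero>\<^bsub>L\<^esub> \<in> H"
    and "\<And>x y. x \<in> H \<Longrightarrow> y \<in> H \<Longrightarrow> x \<oplus>\<^bsub>L\<^esub> y \<in> H"
    and "\<And>x y. x \<in> H \<Longrightarrow> y \<in> H \<Longrightarrow> x \<ominus>\<^bsub>L\<^esub> y \<in> H"
    and "\<And>a x. a \<in> carrier K \<Longrightarrow> x \<in> H \<Longrightarrow> a \<odot>\<^bsub>L\<^esub> x \<in> H"
    and "\<And>x y. x \<in> H \<Longrightarrow> y \<in> H \<Longrightarrow> lie_bracket L x y \<in> H"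
proof -
  have H: "submodule H K L" using assms by (simp add: lie_subalgebra_def)
  note E = submoduleE[OF H]
  show "H \<subseteq> carrier L" by (fact E(1))
  show "\<zero>\<^bsub>L\<^esub> \<in> H" using subgroup.one_closed[OF submodule.axioms(1)[OF H]] by simp
  show "\<And>x y. x \<in> H \<Longrightarrow> y \<in> H \<Longrightarrow> x \<oplus>\<^bsub>L\<^esub> y \<in> H" by (fact E(5))
  show "\<And>x y. x \<in> H \<Longrightarrow> y \<in> H \<Longrightarrow> x \<ominus>\<^bsub>L\<^esub> y \<in> H" by (simp add: M.minus_eq E)
  show "\<And>a x. a \<in> carrier K \<Longrightarrow> x \<in> H \<Longrightarrow> a \<odot>\<^bsub>L\<^esub> x \<in> H" by (fact E(4))
  show "\<And>x y. x \<in> H \<Longrightarrow> y \<in> H \<Longrightarrow> lie_bracket L x y \<in> H"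
    using assms by (simp add: lie_subalgebra_def)
qed

lemma lie_generated_subalgebra:
  assumes "S \<subseteq> carrier L"
  shows "lie_subalgebra K L (lie_generated K L S)"
proof -
  have "lie_subalgebra K L (carrier L)"
    by (simp add: lie_subalgebra_def carrier_is_submodule bracket_closed)
  then have "submodule (lie_generated K L S) K L"
    unfolding lie_generated_def using assms
    by (intro submodule_Inter) (auto simp: lie_subalgebra_def)
  then show ?thesis
    by (auto simp: lie_subalgebra_def lie_generated_def)
qed

lemma bracket_zero_right: "x \<in> carrier L \<Longrightarrow> lie_bracket L x \<zero>\<^bsub>L\<^esub> = \<zero>\<^bsub>L\<^esub>"
  using bracket_smult_right[of "\<zero>" x x] by (simp add: bracket_closed)

lemma bracket_minus_left:
  assumes "x \<in> carrier L" "y \<in> carrier L"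
  shows "lie_bracket L (\<ominus>\<^bsub>L\<^esub> x) y = \<ominus>\<^bsub>L\<^esub> lie_bracket L x y"
  using bracket_smult_left[of "\<ominus> \<one>" x y] assms by (simp add: smult_l_minus bracket_closed)

lemma bracket_minus_right:
  assumes "x \<in> carrier L" "y \<in> carrier L"
  shows "lie_bracket L x (\<ominus>\<^bsub>L\<^esub> y) = \<ominus>\<^bsub>L\<^esub> lie_bracket L x y"
  using bracket_smult_right[of "\<ominus> \<one>" x y] assms by (simp add: smult_l_minus bracket_closed)

lemma bracket_anticomm:
  assumes "x \<in> carrier L" "y \<in> carrier L"
  shows "lie_bracket L x y = \<ominus>\<^bsub>L\<^esub> lie_bracket L y x"
proof -
  have "lie_bracket L x y \<oplus>\<^bsub>L\<^esub> lie_bracket L y x = lie_bracket L (x \<oplus>\<^bsub>L\<^esub> y) (x \<oplus>\<^bsub>L\<^esub> y)"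
    using assms bracket_alternating[of x] bracket_alternating[of y]
    by (simp add: bracket_add_left bracket_add_right bracket_closed M.a_comm)
  also have "\<dots> = \<zero>\<^bsub>L\<^esub>"
    using assms by (simp add: bracket_alternating)
  finally have "lie_bracket L x y \<oplus>\<^bsub>L\<^esub> lie_bracket L y x = \<zero>\<^bsub>L\<^esub>" .
  then show ?thesis
    using assms by (simp add: M.minus_equality bracket_closed)
qed

text \<open>This is the Jacobi identity rearranged by anticommutativity: \<open>ad t\<close> is a
  derivation. Hence stability under \<open>ad t\<close> passes from generators to brackets.\<close>

lemma bracket_derivation:
  assumes "t \<in> carrier L" "x \<in> carrier L" "y \<in> carrier L"
  shows "lie_bracket L t (lie_bracket L x y) =
    lie_bracket L (lie_bracket L t x) y \<oplus>\<^bsub>L\<^esub> lie_bracket L x (lie_bracket L t y)"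
proof -
  have "lie_bracket L x (lie_bracket L y t) = \<ominus>\<^bsub>L\<^esub> lie_bracket L x (lie_bracket L t y)"
    using assms bracket_anticomm[of y t] by (simp add: bracket_minus_right bracket_closed)
  moreover have "lie_bracket L y (lie_bracket L t x) = \<ominus>\<^bsub>L\<^esub> lie_bracket L (lie_bracket L t x) y"
    using assms by (intro bracket_anticomm bracket_closed)
  ultimately have "lie_bracket L t (lie_bracket L x y) \<oplus>\<^bsub>L\<^esub>
      \<ominus>\<^bsub>L\<^esub> (lie_bracket L (lie_bracket L t x) y \<oplus>\<^bsub>L\<^esub> lie_bracket L x (lie_bracket L t y)) = \<zero>\<^bsub>L\<^esub>"
    using jacobi[OF assms] assms by (simp add: bracket_closed M.minus_add M.a_ac)
  from M.minus_equality[OF this] show ?thesis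
    using assms by (simp add: bracket_closed)
qed

end

section \<open>Characters of a Lie algebra and generators of their kernels\<close>

locale lie_character = lie_algebra K L
  for K :: "('k, 'm) ring_scheme" (structure) and L :: "('k, 'l, 'n) lie_algebra_scheme" (structure) +
  fixes f :: "'l \<Rightarrow> 'k"
  assumes char_closed: "x \<in> carrier L \<Longrightarrow> f x \<in> carrier K"
    and char_add: "\<lbrakk>x \<in> carrier L; y \<in> carrier L\<rbrakk> \<Longrightarrow> f (x \<oplus>\<^bsub>L\<^esub> y) = f x \<oplus> f y"
    and char_smult: "\<lbrakk>a \<in> carrier K; x \<in> carrier L\<rbrakk> \<Longrightarrow> f (a \<odot>\<^bsub>L\<^esub> x) = a \<otimes> f x"
    and char_bracket: "\<lbrakk>x \<in> carrier L; y \<in> carrier L\<rbrakk> \<Longrightarrow> f (lie_bracket L x y) = \<zero>"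
begin

lemma char_zero: "f \<zero>\<^bsub>L\<^esub> = \<zero>"
  using char_smult[of \<zero> "\<zero>\<^bsub>L\<^esub>"] by (simp add: char_closed)

lemma char_minus: "x \<in> carrier L \<Longrightarrow> f (\<ominus>\<^bsub>L\<^esub> x) = \<ominus> f x"
  using char_smult[of "\<ominus> \<one>" x] by (simp add: smult_l_minus l_minus char_closed)

lemma kernel_subalgebra: "lie_subalgebra K L {x \<in> carrier L. f x = \<zero>}"
  by (rule lie_subalgebraI)
    (auto simp: char_zero char_add char_smult char_bracket bracket_closed)

text \<open>If \<open>f t = \<one>\<close>, this is the linear projection of \<open>L\<close> onto
  the kernel of \<open>f\<close> along the line spanned by \<open>t\<close>.\<close>

definition proj :: "'l \<Rightarrow> 'l \<Rightarrow> 'l" where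
  "proj t x = x \<ominus>\<^bsub>L\<^esub> f x \<odot>\<^bsub>L\<^esub> t"

lemma proj_closed: "t \<in> carrier L \<Longrightarrow> x \<in> carrier L \<Longrightarrow> proj t x \<in> carrier L"
  by (simp add: proj_def char_closed)

lemma char_proj:
  assumes "t \<in> carrier L" "x \<in> carrier L" "f t = \<one>"
  shows "f (proj t x) = \<zero>"
  using assms
  by (simp add: proj_def M.minus_eq char_add char_minus char_smult char_closed ring_simprules(16))

lemma proj_of_kernel: "t \<in> carrier L \<Longrightarrow> x \<in> carrier L \<Longrightarrow> f x = \<zero> \<Longrightarrow> proj t x = x"
  by (simp add: proj_def M.minus_eq)

lemma proj_add:
  assumes "t \<in> carrier L" "x \<in> carrier L" "y \<in> carrier L"
  shows "proj t (x \<oplus>\<^bsub>L\<^esub> y) = proj t x \<oplus>\<^bsub>L\<^esub> proj t y"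
  using assms
  by (simp add: proj_def M.minus_eq char_add smult_l_distr M.minus_add char_closed M.a_ac)

lemma proj_smult:
  assumes "t \<in> carrier L" "a \<in> carrier K" "x \<in> carrier L"
  shows "proj t (a \<odot>\<^bsub>L\<^esub> x) = a \<odot>\<^bsub>L\<^esub> proj t x"
  using assms
  by (simp add: proj_def M.minus_eq char_smult smult_r_distr smult_r_minus smult_assoc1 char_closed)

text \<open>Passing from \<open>x\<close> to \<open>proj t x\<close> subtracts a multiple of
  \<open>t\<close>, which \<open>ad t\<close> kills.\<close>

lemma bracket_proj:
  assumes "t \<in> carrier L" "x \<in> carrier L"
  shows "lie_bracket L t (proj t x) = lie_bracket L t x"
  using assms
  by (simp add: proj_def M.minus_eq bracket_add_right bracket_minus_right bracket_smult_right
      bracket_alternating bracket_closed char_closed)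

text \<open>Bilinear expansion, in which the term with \<open>[t, t]\<close> drops out. The formula
  trades \<open>[x, y]\<close> for brackets with \<open>t\<close> and a bracket of projected
  elements.\<close>

lemma bracket_proj_proj:
  assumes "t \<in> carrier L" "x \<in> carrier L" "y \<in> carrier L"
  shows "lie_bracket L (proj t x) (proj t y) =
    lie_bracket L x y \<oplus>\<^bsub>L\<^esub> (f y \<odot>\<^bsub>L\<^esub> lie_bracket L t x \<ominus>\<^bsub>L\<^esub> f x \<odot>\<^bsub>L\<^esub> lie_bracket L t y)"
  using assms bracket_anticomm[of x t]
  by (simp add: proj_def M.minus_eq bracket_add_right bracket_minus_right bracket_smult_right
      bracket_add_left bracket_minus_left bracket_smult_left smult_r_minus
      bracket_alternating bracket_closed char_closed minus_zero_module M.a_ac)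

text \<open>Since \<open>[x, y]\<close> vanishes, \<open>bracket_proj_proj\<close> expresses
  \<open>f x\<close> times \<open>[t, y]\<close> through \<open>[t, x]\<close> and the bracket of
  the projections, all in \<open>H\<close>; then divide by \<open>f x\<close>. With \<open>x\<close>
  and \<open>y\<close> adjacent vertices, this moves along one edge.\<close>

lemma bracket_step:
  assumes H: "lie_subalgebra K L H" and t: "t \<in> carrier L"
    and x: "x \<in> carrier L" "proj t x \<in> H" and y: "y \<in> carrier L" "proj t y \<in> H"
    and comm: "lie_bracket L x y = \<zero>\<^bsub>L\<^esub>" and fx: "f x \<noteq> \<zero>"
    and tx: "lie_bracket L t x \<in> H"
  shows "lie_bracket L t y \<in> H"
proof -
  note D = lie_subalgebraD[OF H] and cl = t x(1) y(1) bracket_closed char_closed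
  let ?z = "f y \<odot>\<^bsub>L\<^esub> lie_bracket L t x \<ominus>\<^bsub>L\<^esub> lie_bracket L (proj t x) (proj t y)"
  have "?z = f x \<odot>\<^bsub>L\<^esub> lie_bracket L t y"
    by (simp add: bracket_proj_proj comm cl M.minus_eq M.minus_add flip: M.a_assoc)
       (simp add: cl M.r_neg)
  moreover have "?z \<in> H" using D x y tx by (simp add: char_closed)
  ultimately have "inv (f x) \<odot>\<^bsub>L\<^esub> (f x \<odot>\<^bsub>L\<^esub> lie_bracket L t y) \<in> H"
    using D(5) fx cl by (simp add: field_Units)
  then show ?thesis
    using fx cl by (simp add: field_Units flip: smult_assoc1)
qed

text \<open>The assumption on \<open>S\<close> makes the left side stable under \<open>ad t\<close>,
  and then \<open>proj t\<close> maps all of \<open>L\<close> into it. Both claims are proved by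
  exhibiting a subalgebra that contains the generators.\<close>

lemma kernel_generated:
  assumes t: "t \<in> carrier L" "f t = \<one>"
    and S: "S \<subseteq> carrier L" "lie_generated K L S = carrier L"
    and tS: "\<And>x. x \<in> S \<Longrightarrow> lie_bracket L t x \<in> lie_generated K L (proj t ` S)"
  shows "lie_generated K L (proj t ` S) = {x \<in> carrier L. f x = \<zero>}"
proof
  let ?H = "lie_generated K L (proj t ` S)"
  have pS: "proj t ` S \<subseteq> carrier L" using S(1) t(1) by (auto simp: proj_closed)
  have H: "lie_subalgebra K L ?H" by (rule lie_generated_subalgebra[OF pS])
  note D = lie_subalgebraD[OF H]
  show "?H \<subseteq> {x \<in> carrier L. f x = \<zero>}"
    using S(1) t by (intro lie_generated_subset kernel_subalgebra) (auto simp: proj_closed char_proj)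
  \<comment> \<open>Stability under \<open>ad t\<close>: it holds on the generators by
    \<open>bracket_proj\<close> and \<open>tS\<close>, and survives brackets by the derivation
    rule.\<close>
  have adH: "?H \<subseteq> {h \<in> ?H. lie_bracket L t h \<in> ?H}"
  proof (rule lie_generated_subset[OF lie_subalgebraI])
    show "proj t ` S \<subseteq> {h \<in> ?H. lie_bracket L t h \<in> ?H}"
      using S(1) t(1) tS subset_lie_generated by (fastforce simp: bracket_proj)
    fix x y assume x: "x \<in> {h \<in> ?H. lie_bracket L t h \<in> ?H}"
      and y: "y \<in> {h \<in> ?H. lie_bracket L t h \<in> ?H}"
    then have cl: "x \<in> carrier L" "y \<in> carrier L" using D(1) by auto
    then show "x \<oplus>\<^bsub>L\<^esub> y \<in> {h \<in> ?H. lie_bracket L t h \<in> ?H}"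
      using x y t(1) D by (simp add: bracket_add_right)
    have "lie_bracket L t (lie_bracket L x y) =
        lie_bracket L (lie_bracket L t x) y \<oplus>\<^bsub>L\<^esub> lie_bracket L x (lie_bracket L t y)"
      by (rule bracket_derivation[OF t(1) cl])
    then show "lie_bracket L x y \<in> {h \<in> ?H. lie_bracket L t h \<in> ?H}"
      using x y D by simp
  qed (use D t(1) in \<open>auto simp: bracket_zero_right bracket_smult_right subset_eq\<close>)
  \<comment> \<open>For closure under brackets, \<open>[x, y]\<close> lies in the kernel and so is
    its own projection; \<open>bracket_proj_proj\<close>, solved for \<open>[x, y]\<close>, writes
    it with elements of \<open>?H\<close>, since \<open>[t, x] = [t, proj t x]\<close> is in
    \<open>?H\<close> by \<open>adH\<close>.\<close>
  have "lie_generated K L S \<subseteq> {x \<in> carrier L. proj t x \<in> ?H}"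
  proof (rule lie_generated_subset[OF lie_subalgebraI])
    show "S \<subseteq> {x \<in> carrier L. proj t x \<in> ?H}"
      using S(1) subset_lie_generated by fastforce
    fix x y assume "x \<in> {x \<in> carrier L. proj t x \<in> ?H}" "y \<in> {x \<in> carrier L. proj t x \<in> ?H}"
    then have x: "x \<in> carrier L" "proj t x \<in> ?H" and y: "y \<in> carrier L" "proj t y \<in> ?H"
      by auto
    have "lie_bracket L t x \<in> ?H" "lie_bracket L t y \<in> ?H"
      using adH x y bracket_proj[OF t(1)] by auto
    then have "lie_bracket L (proj t x) (proj t y) \<ominus>\<^bsub>L\<^esub>
        (f y \<odot>\<^bsub>L\<^esub> lie_bracket L t x \<ominus>\<^bsub>L\<^esub> f x \<odot>\<^bsub>L\<^esub> lie_bracket L t y) \<in> ?H"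
      using D x y by (simp add: char_closed)
    also have "lie_bracket L (proj t x) (proj t y) \<ominus>\<^bsub>L\<^esub>
        (f y \<odot>\<^bsub>L\<^esub> lie_bracket L t x \<ominus>\<^bsub>L\<^esub> f x \<odot>\<^bsub>L\<^esub> lie_bracket L t y) = lie_bracket L x y"
      using x y t(1)
      by (simp add: bracket_proj_proj M.minus_eq M.a_assoc M.r_neg bracket_closed char_closed)
    also have "\<dots> = proj t (lie_bracket L x y)"
      using x y t(1) by (simp add: proj_of_kernel bracket_closed char_bracket)
    finally show "lie_bracket L x y \<in> {x \<in> carrier L. proj t x \<in> ?H}"
      using x y by (simp add: bracket_closed)
  qed (use D t(1) in \<open>auto simp: proj_of_kernel char_zero proj_add proj_smult\<close>)
  then show "{x \<in> carrier L. f x = \<zero>} \<subseteq> ?H"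
    using S(2) proj_of_kernel[OF t(1)] by auto
qed

end


section \<open>Linear forms on the abelianization\<close>

context lie_algebra
begin

lemma brackets_subset: "{lie_bracket L x y | x y. x \<in> carrier L \<and> y \<in> carrier L} \<subseteq> carrier L"
  by (auto simp: bracket_closed)

lemma derived_submodule: "submodule (derived_subspace K L) K L"
  unfolding derived_subspace_def by (rule lin_span_submodule[OF brackets_subset])

lemma derived_abelian_subgroup: "abelian_subgroup (derived_subspace K L) L"
  by (intro abelian_subgroupI3 additive_subgroupI submodule.axioms(1)[OF derived_submodule]
      M.abelian_group_axioms)

lemma abelianization_sel:
  "carrier (abelianization K L) = a_rcosets\<^bsub>L\<^esub> (derived_subspace K L)"
  "add (abelianization K L) = set_add L"
  "smult (abelianization K L) =
    (\<lambda>a X. \<Union>x\<in>X. derived_subspace K L +>\<^bsub>L\<^esub> (a \<odot>\<^bsub>L\<^esub> x))"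
  by (simp_all add: abelianization_def quot_module_def)

lemma ab_proj_closed: "x \<in> carrier L \<Longrightarrow> ab_proj K L x \<in> carrier (abelianization K L)"
  using submoduleE(1)[OF derived_submodule]
  by (simp add: ab_proj_def abelianization_sel M.a_rcosetsI)

lemma ab_proj_surj: "P \<in> carrier (abelianization K L) \<Longrightarrow> \<exists>x\<in>carrier L. P = ab_proj K L x"
  by (auto simp: ab_proj_def abelianization_sel A_RCOSETS_def')

lemma ab_proj_add:
  assumes "x \<in> carrier L" "y \<in> carrier L"
  shows "ab_proj K L (x \<oplus>\<^bsub>L\<^esub> y) = ab_proj K L x \<oplus>\<^bsub>abelianization K L\<^esub> ab_proj K L y"
  using abelian_subgroup.a_rcos_sum[OF derived_abelian_subgroup assms]
  by (simp add: ab_proj_def abelianization_sel)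

lemma ab_proj_smult:
  assumes "a \<in> carrier K" "x \<in> carrier L"
  shows "ab_proj K L (a \<odot>\<^bsub>L\<^esub> x) = a \<odot>\<^bsub>abelianization K L\<^esub> ab_proj K L x"
proof -
  let ?N = "derived_subspace K L"
  note N = submoduleE[OF derived_submodule]
  \<comment> \<open>The scalar multiple of a coset is a union over its elements; all members of that
    union turn out to be the same coset.\<close>
  have "?N +>\<^bsub>L\<^esub> (a \<odot>\<^bsub>L\<^esub> y) = ?N +>\<^bsub>L\<^esub> (a \<odot>\<^bsub>L\<^esub> x)" if "y \<in> ?N +>\<^bsub>L\<^esub> x" for y
  proof (rule M.a_repr_independence[symmetric])
    obtain n where n: "n \<in> ?N" "y = n \<oplus>\<^bsub>L\<^esub> x"
      using \<open>y \<in> ?N +>\<^bsub>L\<^esub> x\<close> by (auto simp: a_r_coset_def')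
    then show "a \<odot>\<^bsub>L\<^esub> y \<in> ?N +>\<^bsub>L\<^esub> (a \<odot>\<^bsub>L\<^esub> x)"
      using N(4)[OF assms(1) n(1)] subsetD[OF N(1) n(1)] assms
      by (auto simp: a_r_coset_def' smult_r_distr)
    show "subgroup ?N (add_monoid L)" by (rule submodule.axioms(1)[OF derived_submodule])
  qed (use assms in simp)
  moreover have "x \<in> ?N +>\<^bsub>L\<^esub> x"
    using abelian_subgroup.a_rcos_self[OF derived_abelian_subgroup] assms by simp
  ultimately have "(\<Union>y \<in> ?N +>\<^bsub>L\<^esub> x. ?N +>\<^bsub>L\<^esub> (a \<odot>\<^bsub>L\<^esub> y)) = ?N +>\<^bsub>L\<^esub> (a \<odot>\<^bsub>L\<^esub> x)"
    by blast
  then show ?thesis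
    by (simp add: ab_proj_def abelianization_sel)
qed

lemma ab_proj_bracket:
  assumes "x \<in> carrier L" "y \<in> carrier L"
  shows "ab_proj K L (lie_bracket L x y) = ab_proj K L \<zero>\<^bsub>L\<^esub>"
proof -
  have sg: "subgroup (derived_subspace K L) (add_monoid L)"
    by (rule submodule.axioms(1)[OF derived_submodule])
  have "lie_bracket L x y \<in> derived_subspace K L"
    unfolding derived_subspace_def
    by (rule subsetD[OF subset_lin_span]) (use assms in blast)
  then show ?thesis
    using M.a_coset_join2[OF _ sg] subgroup.one_closed[OF sg] assms
    by (simp add: ab_proj_def bracket_closed)
qed

lemma lie_character_of_form:
  assumes "linear_form K (abelianization K L) \<chi>"
  shows "lie_character K L (\<lambda>x. \<chi> (ab_proj K L x))"
proof
  have hom: "\<chi> \<in> hom (add_monoid (abelianization K L)) (add_monoid K)"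
    and sm: "\<And>a P. a \<in> carrier K \<Longrightarrow> P \<in> carrier (abelianization K L) \<Longrightarrow>
      \<chi> (a \<odot>\<^bsub>abelianization K L\<^esub> P) = a \<otimes> \<chi> P"
    using assms by (auto simp: linear_form_def)
  show cl: "\<chi> (ab_proj K L x) \<in> carrier K" if "x \<in> carrier L" for x
    using hom_in_carrier[OF hom] ab_proj_closed[OF that] by simp
  show "\<chi> (ab_proj K L (x \<oplus>\<^bsub>L\<^esub> y)) = \<chi> (ab_proj K L x) \<oplus> \<chi> (ab_proj K L y)"
    if "x \<in> carrier L" "y \<in> carrier L" for x y
    using hom_mult[OF hom] ab_proj_closed that by (simp add: ab_proj_add)
  show sm': "\<chi> (ab_proj K L (a \<odot>\<^bsub>L\<^esub> x)) = a \<otimes> \<chi> (ab_proj K L x)"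
    if "a \<in> carrier K" "x \<in> carrier L" for a x
    using that by (simp add: ab_proj_smult sm ab_proj_closed)
  show "\<chi> (ab_proj K L (lie_bracket L x y)) = \<zero>" if "x \<in> carrier L" "y \<in> carrier L" for x y
    \<comment> \<open>A bracket has the class of zero, whose value vanishes by homogeneity with the
      scalar \<zero>; the module axioms of the quotient do not enter.\<close>
    using sm'[of \<zero> "\<zero>\<^bsub>L\<^esub>"] cl[of "\<zero>\<^bsub>L\<^esub>"] by (simp add: ab_proj_bracket that)
qed

lemma char_ideal_eq: "char_ideal K L \<chi> = {x \<in> carrier L. \<chi> (ab_proj K L x) = \<zero>}"
  by (auto simp: char_ideal_def a_kernel_def' ab_proj_closed)

end

section \<open>Presented Lie algebras\<close>

abbreviation lie_class ::
    "('k, 'm) ring_scheme \<Rightarrow> 'v set \<Rightarrow> ('k, 'v) lie_term set \<Rightarrow> ('k, 'v) lie_term \<Rightarrow>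
      ('k, 'v) lie_term set" where
  "lie_class K X R s \<equiv> lie_eq K X R `` {s}"

lemma lie_class_closed: "s \<in> lie_terms K X \<Longrightarrow> lie_class K X R s \<in> carrier (presented_lie K X R)"
  by (simp add: presented_lie_def quotientI)

lemma presented_lie_cases:
  assumes "P \<in> carrier (presented_lie K X R)"
  obtains s where "s \<in> lie_terms K X" "P = lie_class K X R s"
  using assms by (auto simp: presented_lie_def elim!: quotientE)

lemma presented_zero: "\<zero>\<^bsub>presented_lie K X R\<^esub> = lie_class K X R Zero"
  by (simp add: presented_lie_def)

context
  fixes K :: "('k, 'm) ring_scheme" and X :: "'v set" and R :: "('k, 'v) lie_term set"
  assumes cring: "cring K"
begin

lemma presented_add:
  assumes "s \<in> lie_terms K X" "t \<in> lie_terms K X"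
  shows "lie_class K X R s \<oplus>\<^bsub>presented_lie K X R\<^esub> lie_class K X R t = lie_class K X R (Add s t)"
proof -
  note E = equiv_lie_eq[OF cring, of X R]
  have "congruent2 (lie_eq K X R) (lie_eq K X R) (\<lambda>s t. lie_class K X R (Add s t))"
    by (auto intro!: congruent2I' equiv_class_eq[OF E] lie_eq.cong_add)
  from UN_equiv_class2[OF E E this assms] show ?thesis by (simp add: presented_lie_def)
qed

lemma presented_smult:
  assumes "a \<in> carrier K" "s \<in> lie_terms K X"
  shows "a \<odot>\<^bsub>presented_lie K X R\<^esub> lie_class K X R s = lie_class K X R (Smult a s)"
proof -
  note E = equiv_lie_eq[OF cring, of X R]
  have "(\<lambda>s. lie_class K X R (Smult a s)) respects lie_eq K X R"
    using assms(1) by (auto intro!: congruentI equiv_class_eq[OF E] lie_eq.cong_smult)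
  from UN_equiv_class[OF E this assms(2)] show ?thesis by (simp add: presented_lie_def)
qed

lemma presented_bracket:
  assumes "s \<in> lie_terms K X" "t \<in> lie_terms K X"
  shows "lie_bracket (presented_lie K X R) (lie_class K X R s) (lie_class K X R t) =
    lie_class K X R (Bracket s t)"
proof -
  note E = equiv_lie_eq[OF cring, of X R]
  have "congruent2 (lie_eq K X R) (lie_eq K X R) (\<lambda>s t. lie_class K X R (Bracket s t))"
    by (auto intro!: congruent2I' equiv_class_eq[OF E] lie_eq.cong_bracket)
  from UN_equiv_class2[OF E E this assms] show ?thesis by (simp add: presented_lie_def)
qed

end

text \<open>Induction on terms: the class of a compound term is the corresponding operation applied
  to the classes of its parts.\<close>

lemma presented_generated:
  assumes "Ring.field K"
  shows "lie_generated K (presented_lie K X R) ((\<lambda>v. lie_class K X R (Gen v)) ` X) =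
    carrier (presented_lie K X R)" (is "lie_generated K ?L ?S = _")
proof
  interpret Ring.field K by fact
  interpret lie_algebra K ?L by (rule presented_lie_algebra[OF assms])
  note ops = presented_add[OF is_cring] presented_smult[OF is_cring]
    presented_bracket[OF is_cring] presented_zero
  have S: "?S \<subseteq> carrier ?L" by (auto intro: lie_class_closed lie_terms.gen)
  note H = lie_generated_subalgebra[OF S]
  show "lie_generated K ?L ?S \<subseteq> carrier ?L" by (rule lie_subalgebraD(1)[OF H])
  have "lie_class K X R s \<in> lie_generated K ?L ?S" if "s \<in> lie_terms K X" for s
    using that
  proof induction
    case (gen v) then show ?case using subset_lie_generated by fastforce
  qed (use lie_subalgebraD[OF H] in \<open>simp_all flip: ops\<close>)
  then show "carrier ?L \<subseteq> lie_generated K ?L ?S"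
    by (blast elim: presented_lie_cases)
qed

section \<open>A metabelian representation and infinite generation\<close>

primrec term_char :: "('k, 'm) ring_scheme \<Rightarrow> ('v \<Rightarrow> 'k) \<Rightarrow> ('k, 'v) lie_term \<Rightarrow> 'k" where
  "term_char K l (Gen v) = l v"
| "term_char K l Zero = \<zero>\<^bsub>K\<^esub>"
| "term_char K l (Add s t) = term_char K l s \<oplus>\<^bsub>K\<^esub> term_char K l t"
| "term_char K l (Smult a s) = a \<otimes>\<^bsub>K\<^esub> term_char K l s"
| "term_char K l (Bracket s t) = \<zero>\<^bsub>K\<^esub>"

text \<open>
  \<open>(term_char K l s, \<Sum>\<^sub>n term_coeff K l p s n x\<^sup>n)\<close> is the value of \<open>s\<close> in the Lie algebra
  \<open>K \<times> K[x]\<close> with bracket \<open>[(a, f), (b, g)] = (0, x (a g - b f))\<close>, if the generator \<open>v\<close> is mapped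
  to \<open>(l v, p v)\<close>.
\<close>

primrec term_coeff ::
    "('k, 'm) ring_scheme \<Rightarrow> ('v \<Rightarrow> 'k) \<Rightarrow> ('v \<Rightarrow> 'k) \<Rightarrow> ('k, 'v) lie_term \<Rightarrow> nat \<Rightarrow> 'k" where
  "term_coeff K l p (Gen v) = (\<lambda>n. if n = 0 then p v else \<zero>\<^bsub>K\<^esub>)"
| "term_coeff K l p Zero = (\<lambda>n. \<zero>\<^bsub>K\<^esub>)"
| "term_coeff K l p (Add s t) = (\<lambda>n. term_coeff K l p s n \<oplus>\<^bsub>K\<^esub> term_coeff K l p t n)"
| "term_coeff K l p (Smult a s) = (\<lambda>n. a \<otimes>\<^bsub>K\<^esub> term_coeff K l p s n)"
| "term_coeff K l p (Bracket s t) = (\<lambda>n. case n of 0 \<Rightarrow> \<zero>\<^bsub>K\<^esub> | Suc m \<Rightarrow>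
     term_char K l s \<otimes>\<^bsub>K\<^esub> term_coeff K l p t m \<ominus>\<^bsub>K\<^esub> term_char K l t \<otimes>\<^bsub>K\<^esub> term_coeff K l p s m)"

context
  fixes K :: "('k, 'm) ring_scheme" (structure) and X :: "'v set" and l p :: "'v \<Rightarrow> 'k"
  assumes cring: "cring K" and l: "\<And>v. v \<in> X \<Longrightarrow> l v \<in> carrier K"
    and p: "\<And>v. v \<in> X \<Longrightarrow> p v \<in> carrier K"
begin

interpretation cring K by (fact cring)

lemma term_char_closed: "s \<in> lie_terms K X \<Longrightarrow> term_char K l s \<in> carrier K"
  by (induction rule: lie_terms.induct) (simp_all add: l)

lemma term_coeff_closed: "s \<in> lie_terms K X \<Longrightarrow> term_coeff K l p s n \<in> carrier K"
  by (induction arbitrary: n rule: lie_terms.induct)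
     (auto simp: p term_char_closed split: nat.split)

text \<open>The coefficient functions are thus those of polynomials. The factor \<open>x\<close> in
  the bracket raises the degree bound by one.\<close>

lemma term_coeff_bounded: "s \<in> lie_terms K X \<Longrightarrow> \<exists>N. \<forall>n\<ge>N. term_coeff K l p s n = \<zero>"
proof (induction rule: lie_terms.induct)
  case (gen v) then show ?case by (intro exI[of _ 1]) auto
next
  case (add s t)
  then obtain N N' where "\<forall>n\<ge>N. term_coeff K l p s n = \<zero>" "\<forall>n\<ge>N'. term_coeff K l p t n = \<zero>"
    by blast
  then show ?case by (intro exI[of _ "max N N'"]) simp
next
  case (bracket s t)
  then obtain N N' where "\<forall>n\<ge>N. term_coeff K l p s n = \<zero>" "\<forall>n\<ge>N'. term_coeff K l p t n = \<zero>"
    by blast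
  then show ?case using bracket(1,2)
    by (intro exI[of _ "Suc (max N N')"]) (auto simp: term_char_closed minus_eq split: nat.split)
next
  case (smult a s)
  then obtain N where "\<forall>n\<ge>N. term_coeff K l p s n = \<zero>" by blast
  with smult(1) show ?case by (intro exI[of _ N]) simp
qed auto

text \<open>Evaluation descends to the presented Lie algebra: each rule of \<open>lie_eq\<close> is
  checked coefficientwise, which amounts to the Lie axioms in \<open>K \<times> K[x]\<close>
  together with the vanishing of the relators.\<close>

lemma term_values_respect:
  assumes R: "\<And>r. r \<in> R \<Longrightarrow> term_char K l r = \<zero> \<and> (\<forall>n. term_coeff K l p r n = \<zero>)"
    and "(s, t) \<in> lie_eq K X R"
  shows "term_char K l s = term_char K l t \<and> (\<forall>n. term_coeff K l p s n = term_coeff K l p t n)"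
  using assms(2)
  supply c = term_char_closed term_coeff_closed
proof (induction rule: lie_eq.induct)
  case (jacobi s t u)
  \<comment> \<open>The Jacobi sum at degree \<open>n + 2\<close>: \<open>a\<close>,
    \<open>b\<close>, \<open>c\<close> are the first components of the three terms and
    \<open>u\<close>, \<open>v\<close>, \<open>w\<close> their coefficients at \<open>n\<close>.
    Each subtracted \<zero> comes from the first component of an inner bracket.\<close>
  have "a \<otimes> (b \<otimes> w \<ominus> c \<otimes> v) \<ominus> \<zero> \<oplus> (b \<otimes> (c \<otimes> u \<ominus> a \<otimes> w) \<ominus> \<zero>) \<oplus> (c \<otimes> (a \<otimes> v \<ominus> b \<otimes> u) \<ominus> \<zero>) = \<zero>"
    if "a \<in> carrier K" "b \<in> carrier K" "c \<in> carrier K"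
      "u \<in> carrier K" "v \<in> carrier K" "w \<in> carrier K" for a b c u v w
    using that by algebra
  note id = this[OF term_char_closed[OF jacobi(1)] term_char_closed[OF jacobi(2)]
      term_char_closed[OF jacobi(3)] term_coeff_closed[OF jacobi(1)]
      term_coeff_closed[OF jacobi(2)] term_coeff_closed[OF jacobi(3)]]
  have z: "\<zero> \<ominus> \<zero> = \<zero>" by algebra
  show ?case
    using jacobi id by (auto simp: z c split: nat.split)
next
  case (bracket_alternating s)
  then show ?case by (auto simp: c r_neg minus_eq split: nat.split)
next
  case (bracket_add_left s t u)
  then show ?case
    by (auto simp: c l_distr r_distr minus_eq minus_add a_ac split: nat.split)
next
  case (bracket_add_right s t u)
  then show ?case
    by (auto simp: c l_distr r_distr minus_eq minus_add a_ac split: nat.split)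
next
  case (bracket_smult_left a s t)
  then show ?case by (auto simp: c r_distr r_minus minus_eq m_ac split: nat.split)
next
  case (bracket_smult_right a s t)
  then show ?case by (auto simp: c r_distr r_minus minus_eq m_ac split: nat.split)
next
  case (add_neg s)
  then show ?case by (simp add: c l_minus l_neg)
qed (use R in \<open>simp_all add: c a_ac m_ac r_distr l_distr split: nat.split\<close>)

end

text \<open>Kernel elements with polynomials of degree below \<open>N\<close> form a subalgebra, and
  a finite set of kernel elements lies in one of these. Iterated brackets with the generator
  \<open>v0\<close> nevertheless give kernel elements of every degree.\<close>

lemma presented_not_fin_gen:
  fixes K :: "('k, 'm) ring_scheme" (structure) and R :: "('k, 'v) lie_term set"
  assumes char: "lie_character K (presented_lie K X R) f"
    and l_def: "l = (\<lambda>v. f (lie_class K X R (Gen v)))"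
    and p: "\<And>v. v \<in> X \<Longrightarrow> p v \<in> carrier K"
    and R: "\<And>r. r \<in> R \<Longrightarrow> term_char K l r = \<zero> \<and> (\<forall>n. term_coeff K l p r n = \<zero>)"
    and v: "v0 \<in> X" "v1 \<in> X" "l v0 \<noteq> \<zero>" "l v0 \<otimes> p v1 \<noteq> l v1 \<otimes> p v0"
  shows "\<not> fin_gen_lie K (presented_lie K X R) {x \<in> carrier (presented_lie K X R). f x = \<zero>}"
proof
  let ?L = "presented_lie K X R" and ?c = "lie_class K X R"
  interpret lie_character K ?L f by (fact char)
  note ops = presented_add[OF is_cring] presented_smult[OF is_cring]
    presented_bracket[OF is_cring] presented_zero
  have l: "l v \<in> carrier K" if "v \<in> X" for v
    using that by (auto simp: l_def intro!: char_closed lie_class_closed lie_terms.gen)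
  note closed = term_char_closed[where X = X and l = l and p = p, OF is_cring l p]
    term_coeff_closed[where X = X and l = l and p = p, OF is_cring l p]
  have f_class: "f (?c s) = term_char K l s" if "s \<in> lie_terms K X" for s
    using that
    by induction
      (simp_all add: l_def char_zero char_add char_smult char_bracket lie_class_closed flip: ops)
  \<comment> \<open>One suitable representative is enough for membership; independence of the
    representative is invoked at the very end.\<close>
  define H where "H N = {?c s | s. s \<in> lie_terms K X \<and> term_char K l s = \<zero> \<and>
    (\<forall>n\<ge>N. term_coeff K l p s n = \<zero>)}" for N :: nat
  have H: "lie_subalgebra K ?L (H N)" for N
  proof (rule lie_subalgebraI)
    fix x y assume "x \<in> H N" "y \<in> H N"
    then obtain s t where s: "x = ?c s" "s \<in> lie_terms K X" "term_char K l s = \<zero>"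
        "\<forall>n\<ge>N. term_coeff K l p s n = \<zero>"
      and t: "y = ?c t" "t \<in> lie_terms K X" "term_char K l t = \<zero>"
        "\<forall>n\<ge>N. term_coeff K l p t n = \<zero>"
      by (auto simp: H_def)
    show "x \<oplus>\<^bsub>?L\<^esub> y \<in> H N"
      unfolding H_def using s t
      by (auto simp: ops intro!: exI[of _ "Add s t"] lie_terms.intros)
    \<comment> \<open>Both first components are zero, so every coefficient of the bracket vanishes
      and the bound \<open>N\<close> does not grow.\<close>
    show "lie_bracket ?L x y \<in> H N"
      unfolding H_def using s t
      by (auto simp: ops closed a_minus_def intro!: exI[of _ "Bracket s t"] lie_terms.intros split: nat.split)
  next
    fix a x assume "a \<in> carrier K" "x \<in> H N"
    then show "a \<odot>\<^bsub>?L\<^esub> x \<in> H N"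
      unfolding H_def by (fastforce simp: ops intro: lie_terms.intros)
  qed (auto simp: H_def ops lie_class_closed intro!: exI[of _ Zero] lie_terms.intros)
  assume "fin_gen_lie K ?L {x \<in> carrier ?L. f x = \<zero>}"
  then obtain S where S: "finite S" "S \<subseteq> {x \<in> carrier ?L. f x = \<zero>}"
    and gen: "lie_generated K ?L S = {x \<in> carrier ?L. f x = \<zero>}"
    by (auto simp: fin_gen_lie_def)
  from S have "\<exists>N. S \<subseteq> H N"
  proof (induction rule: finite_induct)
    case (insert x S)
    then obtain N where N: "S \<subseteq> H N" by auto
    from insert obtain s where s: "x = ?c s" "s \<in> lie_terms K X"
      by (auto elim: presented_lie_cases)
    obtain M where M: "\<forall>n\<ge>M. term_coeff K l p s n = \<zero>"
      using term_coeff_bounded[where X = X and l = l and p = p, OF is_cring l p s(2)] by blast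
    have "x \<in> H (max M N)" using s M insert.prems by (auto simp: H_def f_class)
    moreover have "H N \<subseteq> H (max M N)" by (auto simp: H_def)
    ultimately show ?case using N by blast
  qed simp
  then obtain N where "S \<subseteq> H N" by blast
  then have sub: "{x \<in> carrier ?L. f x = \<zero>} \<subseteq> H N"
    using lie_generated_subset[OF H] gen by blast
  \<comment> \<open>The starting term has first component zero and constant coefficient
    \<open>l v0 \<otimes> p v1 \<ominus> l v1 \<otimes> p v0\<close>, which is nonzero. Each bracket
    with \<open>v0\<close> multiplies the polynomial by \<open>l v0\<close> times \<open>x\<close>,
    so \<open>t n\<close> has degree \<open>n\<close>.\<close>
  define t where "t = rec_nat (Add (Smult (l v0) (Gen v1)) (Smult (\<ominus> l v1) (Gen v0)))
    (\<lambda>_ s. Bracket (Gen v0) s)"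
  have t0: "t 0 = Add (Smult (l v0) (Gen v1)) (Smult (\<ominus> l v1) (Gen v0))"
    and tSuc: "t (Suc n) = Bracket (Gen v0) (t n)" for n
    by (simp_all add: t_def)
  have t: "t n \<in> lie_terms K X" for n
    using v l by (induction n) (auto simp: t0 tSuc intro!: lie_terms.intros)
  have char_t: "term_char K l (t n) = \<zero>" for n
    using v l by (cases n) (auto simp: t0 tSuc l_minus r_minus m_comm ring_simprules(16))
  have coeff_t: "term_coeff K l p (t n) n \<noteq> \<zero>" for n
  proof (induction n)
    case 0
    have "a = (a \<ominus> b) \<oplus> b" if "a \<in> carrier K" "b \<in> carrier K" for a b
      using that by algebra
    from this[of "l v0 \<otimes> p v1" "l v1 \<otimes> p v0"] have "l v0 \<otimes> p v1 \<ominus> l v1 \<otimes> p v0 \<noteq> \<zero>"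
      using v l p by auto
    then show ?case using v l p by (simp add: t0 l_minus a_minus_def)
  next
    case (Suc n)
    then show ?case using v l p char_t t closed by (simp add: tSuc a_minus_def integral_iff)
  qed
  \<comment> \<open>Degrees in \<open>H N\<close> are strictly below \<open>N\<close>, so degree
    exactly \<open>N\<close> already gives the contradiction.\<close>
  have "?c (t N) \<in> H N"
    using sub t char_t by (auto simp: f_class lie_class_closed)
  then obtain s where s: "s \<in> lie_terms K X" "?c s = ?c (t N)" "term_coeff K l p s N = \<zero>"
    by (auto simp: H_def)
  have "(s, t N) \<in> lie_eq K X R"
    using eq_equiv_class[OF s(2) equiv_lie_eq[OF is_cring] t] .
  then have "term_coeff K l p s N = term_coeff K l p (t N) N"
    using term_values_respect[where X = X and l = l and p = p, OF is_cring l p R] by blast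
  then show False using s(3) coeff_t[of N] by simp
qed

section \<open>Connectedness and dominance\<close>

text \<open>Connectedness is defined through the symmetric closure, which leaves reachability
  unchanged because the induced subgraph is already symmetric.\<close>

lemma (in sym_digraph) connected_induce_iff:
  assumes "A \<subseteq> verts G"
  shows "Digraph_Component.connected (G \<restriction> A) \<longleftrightarrow>
    A \<noteq> {} \<and> (\<forall>u\<in>A. \<forall>v\<in>A. u \<rightarrow>\<^sup>*\<^bsub>G \<restriction> A\<^esub> v)"
proof -
  have wf: "wf_digraph (G \<restriction> A)" by (rule wellformed_induce_subgraph)
  have "symmetric (G \<restriction> A)"
    by (rule induced_graph_imp_symmetric[OF sym_arcs induced_induce[OF assms]])
  from wf_digraph.reachable_mk_symmetric_eq[OF wf this] show ?thesis
    by (simp add: Digraph_Component.connected_def strongly_connected_def)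
qed


text \<open>The edge equation is what makes the relators vanish in the metabelian representation;
  the final inequality provides the nonzero constant coefficient.\<close>

lemma obstruction_of_not_connected_dominant:
  fixes K :: "('k, 'm) ring_scheme" (structure) and \<Gamma> :: "('v, 'e) pre_digraph"
  assumes "Ring.field K" "sym_digraph \<Gamma>"
    and l: "\<And>v. v \<in> verts \<Gamma> \<Longrightarrow> l v \<in> carrier K"
    and v0: "v0 \<in> verts \<Gamma>" "l v0 \<noteq> \<zero>"
    and neg: "\<not> (Digraph_Component.connected (\<Gamma> \<restriction> {v \<in> verts \<Gamma>. l v \<noteq> \<zero>}) \<and>
      dominant_in (\<Gamma> \<restriction> {v \<in> verts \<Gamma>. l v \<noteq> \<zero>}) \<Gamma>)"
  shows "\<exists>p v0 v1. (\<forall>v \<in> verts \<Gamma>. p v \<in> carrier K) \<and>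
    (\<forall>v w. v \<rightarrow>\<^bsub>\<Gamma>\<^esub> w \<longrightarrow> l v \<otimes> p w = l w \<otimes> p v) \<and> v0 \<in> verts \<Gamma> \<and> v1 \<in> verts \<Gamma> \<and>
    l v0 \<noteq> \<zero> \<and> l v0 \<otimes> p v1 \<noteq> l v1 \<otimes> p v0"
proof -
  interpret Ring.field K by fact
  interpret sym_digraph \<Gamma> by fact
  define A where "A = {v \<in> verts \<Gamma>. l v \<noteq> \<zero>}"
  interpret A: wf_digraph "\<Gamma> \<restriction> A" by (rule wellformed_induce_subgraph)
  have A: "A \<subseteq> verts \<Gamma>" "v0 \<in> A" using v0 by (auto simp: A_def)
  have A_iff: "v \<in> A \<longleftrightarrow> l v \<noteq> \<zero>" if "v \<in> verts \<Gamma>" for v using that by (simp add: A_def)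
  have sym: "w \<rightarrow>\<^bsub>\<Gamma>\<^esub> v" if "v \<rightarrow>\<^bsub>\<Gamma>\<^esub> w" for v w using that by (rule graph_symmetric)
  show ?thesis
  proof (cases "Digraph_Component.connected (\<Gamma> \<restriction> A)")
    case True
    then have "\<not> dominant_in (\<Gamma> \<restriction> A) \<Gamma>" using neg by (simp add: A_def)
    then obtain v1 where v1: "v1 \<in> verts \<Gamma>" "v1 \<notin> A" and no: "\<And>w. w \<in> A \<Longrightarrow> \<not> v1 \<rightarrow>\<^bsub>\<Gamma>\<^esub> w"
      by (auto simp: dominant_in_def)
    \<comment> \<open>Only edges at \<open>v1\<close> matter for the edge equation, and there both
      ends have \<open>l\<close> equal to \<zero>. The inequality at \<open>v0\<close>,
      \<open>v1\<close> holds because \<open>l v0 \<noteq> \<zero>\<close> and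
      \<open>l v1 = \<zero>\<close>.\<close>
    define p where "p v = (if v = v1 then \<one> else \<zero>)" for v
    have z: "l w = \<zero>" if "v1 \<rightarrow>\<^bsub>\<Gamma>\<^esub> w" for w
      using no that adj_in_verts(2) by (auto simp: A_def)
    have "l v \<otimes> p w = l w \<otimes> p v" if "v \<rightarrow>\<^bsub>\<Gamma>\<^esub> w" for v w
      using that adj_in_verts[OF that] z sym[OF that] by (auto simp: p_def l)
    moreover have "l v0 \<otimes> p v1 \<noteq> l v1 \<otimes> p v0"
      using v0 v1 A l by (auto simp: p_def A_def)
    moreover have "p v \<in> carrier K" for v by (simp add: p_def)
    ultimately show ?thesis using v0 v1 by blast
  next
    case False
    \<comment> \<open>As \<open>A\<close> contains \<open>v0\<close>, disconnectedness is not due to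
      emptiness.\<close>
    then obtain u v1 where uv: "u \<in> A" "v1 \<in> A" "\<not> u \<rightarrow>\<^sup>*\<^bsub>\<Gamma> \<restriction> A\<^esub> v1"
      using A connected_induce_iff[OF A(1)] by blast
    \<comment> \<open>An edge inside \<open>A\<close> has both ends in the component of
      \<open>u\<close> or neither; at an end outside \<open>A\<close> both \<open>l\<close> and
      \<open>p\<close> vanish. So the edge equation holds, while \<open>u\<close> and
      \<open>v1\<close> violate proportionality.\<close>
    define p where "p v = (if v \<in> A \<and> u \<rightarrow>\<^sup>*\<^bsub>\<Gamma> \<restriction> A\<^esub> v then l v else \<zero>)" for v
    have step: "u \<rightarrow>\<^sup>*\<^bsub>\<Gamma> \<restriction> A\<^esub> w" if "u \<rightarrow>\<^sup>*\<^bsub>\<Gamma> \<restriction> A\<^esub> v" "v \<rightarrow>\<^bsub>\<Gamma>\<^esub> w" "v \<in> A" "w \<in> A" for v w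
    proof -
      have "v \<rightarrow>\<^bsub>\<Gamma> \<restriction> A\<^esub> w" using that(2-4) by (auto simp: arcs_ends_conv)
      then show ?thesis using that(1) A.reachable_adj_trans by blast
    qed
    have "l v \<otimes> p w = l w \<otimes> p v" if "v \<rightarrow>\<^bsub>\<Gamma>\<^esub> w" for v w
      using step[of v w] step[of w v] that adj_in_verts[OF that] sym[OF that]
      by (cases "l v = \<zero>"; cases "l w = \<zero>") (auto simp: p_def A_iff l m_comm)
    moreover have "l u \<otimes> p v1 \<noteq> l v1 \<otimes> p u"
    proof -
      have "p v1 = \<zero>" "p u = l u" using uv A.reachable_refl[of u] by (simp_all add: p_def)
      moreover have "l v1 \<otimes> l u \<noteq> \<zero>" using uv l by (simp add: A_def integral_iff)
      ultimately show ?thesis using uv l by (simp add: A_def)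
    qed
    moreover have "p v \<in> carrier K" if "v \<in> verts \<Gamma>" for v using that l by (simp add: p_def)
    ultimately show ?thesis using uv by (auto simp: A_def)
  qed
qed

text \<open>By \<open>kernel_generated\<close> it suffices that \<open>[t, g v]\<close> lies in the
  generated subalgebra for every vertex. This spreads by \<open>bracket_step\<close> from one vertex
  of the subgraph to the whole subgraph by connectedness, and to the other vertices by dominance.
  That \<open>t\<close> lies in the span later puts the generators into the kernel of \<chi> on the
  span.\<close>

lemma kernel_generated_of_connected_dominant:
  fixes K :: "('k, 'm) ring_scheme" (structure) and \<Gamma> :: "('v, 'e) pre_digraph"
    and L :: "('k, 'l, 'n) lie_algebra_scheme" (structure)
  assumes "lie_character K L f" "sym_digraph \<Gamma>"
    and g: "\<And>v. v \<in> verts \<Gamma> \<Longrightarrow> g v \<in> carrier L"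
    and gen: "lie_generated K L (g ` verts \<Gamma>) = carrier L"
    and comm: "\<And>v w. v \<rightarrow>\<^bsub>\<Gamma>\<^esub> w \<Longrightarrow> lie_bracket L (g v) (g w) = \<zero>\<^bsub>L\<^esub>"
    and con: "Digraph_Component.connected (\<Gamma> \<restriction> {v \<in> verts \<Gamma>. f (g v) \<noteq> \<zero>})"
    and dom: "dominant_in (\<Gamma> \<restriction> {v \<in> verts \<Gamma>. f (g v) \<noteq> \<zero>}) \<Gamma>"
  shows "\<exists>t \<in> lin_span K L (g ` verts \<Gamma>).
    lie_generated K L ((\<lambda>v. g v \<ominus>\<^bsub>L\<^esub> f (g v) \<odot>\<^bsub>L\<^esub> t) ` verts \<Gamma>) = {x \<in> carrier L. f x = \<zero>}"
proof -
  interpret lie_character K L f by fact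
  interpret sym_digraph \<Gamma> by fact
  define A where "A = {v \<in> verts \<Gamma>. f (g v) \<noteq> \<zero>}"
  have "A \<subseteq> verts \<Gamma>" by (auto simp: A_def)
  then obtain v0 where v0: "v0 \<in> A" and reach: "\<And>v. v \<in> A \<Longrightarrow> v0 \<rightarrow>\<^sup>*\<^bsub>\<Gamma> \<restriction> A\<^esub> v"
    using con connected_induce_iff[of A] unfolding A_def by blast
  have gv0: "g v0 \<in> carrier L" and "f (g v0) \<in> Units K"
    using v0 by (auto simp: A_def field_Units g char_closed)
  note inv = Units_inv_closed[OF this(2)] Units_l_inv[OF this(2)]
  have gS: "g ` verts \<Gamma> \<subseteq> carrier L" using g by blast
  \<comment> \<open>Scaled so that \<open>f t = \<one>\<close>; being a multiple of
    \<open>g v0\<close>, it satisfies \<open>[t, g v0] = 0\<close>, where the propagation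
    starts.\<close>
  define t where "t = inv (f (g v0)) \<odot>\<^bsub>L\<^esub> g v0"
  have t: "t \<in> carrier L" "f t = \<one>"
    unfolding t_def using inv gv0 by (simp_all only: smult_closed char_smult)
  have t_span: "t \<in> lin_span K L (g ` verts \<Gamma>)"
    unfolding t_def
    by (rule submoduleE(4)[OF lin_span_submodule[OF gS] inv(1)])
      (use v0 subset_lin_span in \<open>fastforce simp: A_def\<close>)
  let ?H = "lie_generated K L (proj t ` g ` verts \<Gamma>)"
  have pS: "proj t ` g ` verts \<Gamma> \<subseteq> carrier L" using g t(1) by (auto simp: proj_closed)
  note H = lie_generated_subalgebra[OF pS]
  have projH: "proj t (g v) \<in> ?H" if "v \<in> verts \<Gamma>" for v
    using that subset_lie_generated by fastforce
  \<comment> \<open>The division in \<open>bracket_step\<close> requires \<open>v \<in> A\<close>,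
    but \<open>w\<close> may be any neighbour; this is why a vertex outside \<open>A\<close> can be
    reached by one last edge.\<close>
  have ad_step: "lie_bracket L t (g w) \<in> ?H"
    if "lie_bracket L t (g v) \<in> ?H" "v \<in> A" "v \<rightarrow>\<^bsub>\<Gamma>\<^esub> w" for v w
    using bracket_step[OF H t(1) g projH g projH comm[OF that(3)]] that adj_in_verts[OF that(3)]
    by (simp add: A_def)
  have tA: "lie_bracket L t (g v) \<in> ?H" if "v \<in> A" for v
    using reach[OF that]
  proof (induction rule: wf_digraph.reachable_induct[OF wellformed_induce_subgraph, consumes 1, case_names base step])
    case base
    have "lie_bracket L t (g v0) = \<zero>\<^bsub>L\<^esub>"
      unfolding t_def bracket_smult_left[OF inv(1) gv0 gv0] bracket_alternating[OF gv0]
      by (rule smult_r_null[OF inv(1)])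
    then show ?case using lie_subalgebraD(2)[OF H] by simp
  next
    case (step x y)
    have "x \<in> A" using wf_digraph.adj_in_verts(1)[OF wellformed_induce_subgraph step(2)] by simp
    then show ?case
      using ad_step[OF step(3)] dominates_induce_subgraphD[OF step(2)] by blast
  qed
  have "lie_bracket L t (g v) \<in> ?H" if v: "v \<in> verts \<Gamma>" for v
  proof (cases "v \<in> A")
    case False
    with dom v obtain w where "w \<in> A" "v \<rightarrow>\<^bsub>\<Gamma>\<^esub> w" by (auto simp: dominant_in_def A_def)
    with ad_step[OF tA] graph_symmetric show ?thesis by blast
  qed (rule tA)
  then have "?H = {x \<in> carrier L. f x = \<zero>}"
    by (intro kernel_generated[OF t gS gen]) blast
  then show ?thesis
    using t_span by (auto simp: image_image proj_def)
qed

section \<open>Application to right angled Artin Lie algebras\<close>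

theorem corollaryE:
  fixes K :: "('k, 'm) ring_scheme"
    and \<Gamma> :: "('v, 'e) pre_digraph"
    and \<chi> :: "('k, 'v) lie_term set set \<Rightarrow> 'k"
  assumes "Ring.field K"
    and "graph \<Gamma>"
    and "linear_form K (abelianization K (raag_lie K \<Gamma>)) \<chi>"
    and "\<exists>x \<in> carrier (abelianization K (raag_lie K \<Gamma>)). \<chi> x \<noteq> \<zero>\<^bsub>K\<^esub>"
  shows "(fin_gen_lie K (raag_lie K \<Gamma>) (char_ideal K (raag_lie K \<Gamma>) \<chi>)
            \<longleftrightarrow> Digraph_Component.connected (char_subgraph K \<Gamma> \<chi>) \<and> dominant_in (char_subgraph K \<Gamma> \<chi>) \<Gamma>)
       \<and> (Digraph_Component.connected (char_subgraph K \<Gamma> \<chi>) \<and> dominant_in (char_subgraph K \<Gamma> \<chi>) \<Gamma>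
            \<longrightarrow> lie_generated K (raag_lie K \<Gamma>) (raag_ker K \<Gamma> \<chi>)
                  = char_ideal K (raag_lie K \<Gamma>) \<chi>)"
proof -
  interpret K: Ring.field K by fact
  interpret G: graph \<Gamma> by fact
  let ?X = "verts \<Gamma>" and ?R = "raag_relators \<Gamma> :: ('k, 'v) lie_term set"
  define L where "L = raag_lie K \<Gamma>"
  have L: "L = presented_lie K ?X ?R" by (simp add: L_def raag_lie_def)
  interpret lie_algebra K L unfolding L by (rule presented_lie_algebra[OF assms(1)])
  define f where "f = (\<lambda>x. \<chi> (ab_proj K L x))"
  interpret lie_character K L f
    unfolding f_def by (rule lie_character_of_form) (use assms(3) in \<open>simp add: L_def\<close>)
  define I where "I = {x \<in> carrier L. f x = \<zero>\<^bsub>K\<^esub>}"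
  have I: "char_ideal K L \<chi> = I" by (simp add: char_ideal_eq I_def f_def)
  define g where "g = raag_gen K \<Gamma>"
  have g: "g v \<in> carrier L" if "v \<in> ?X" for v
    using that by (auto simp: g_def L raag_gen_def intro: lie_class_closed lie_terms.gen)
  have gS: "g ` ?X \<subseteq> carrier L" using g by blast
  have gen: "lie_generated K L (g ` ?X) = carrier L"
    using presented_generated[OF assms(1), of ?X ?R] by (simp add: L g_def raag_gen_def)
  have comm: "lie_bracket L (g v) (g w) = \<zero>\<^bsub>L\<^esub>" if vw: "v \<rightarrow>\<^bsub>\<Gamma>\<^esub> w" for v w
  proof -
    have T: "Gen v \<in> lie_terms K ?X" "Gen w \<in> lie_terms K ?X"
      using G.adj_in_verts[OF vw] by (auto intro: lie_terms.gen)
    have "lie_class K ?X ?R (Bracket (Gen v) (Gen w)) = \<zero>\<^bsub>L\<^esub>"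
      unfolding L using vw T
      by (intro presented_relator[OF assms(1)] lie_terms.bracket) (auto simp: raag_relators_def)
    then show ?thesis
      using presented_bracket[OF K.is_cring T, of ?R] by (simp add: g_def raag_gen_def L)
  qed
  have sub: "char_subgraph K \<Gamma> \<chi> = \<Gamma> \<restriction> {v \<in> ?X. f (g v) \<noteq> \<zero>\<^bsub>K\<^esub>}"
    by (simp add: char_subgraph_def f_def g_def L_def)
  let ?P = "Digraph_Component.connected (char_subgraph K \<Gamma> \<chi>) \<and> dominant_in (char_subgraph K \<Gamma> \<chi>) \<Gamma>"
  note span = lin_span_submodule[OF gS]
  \<comment> \<open>In this form, any generators of \<open>I\<close> found inside the vertex span
    belong to \<open>raag_ker K \<Gamma> \<chi>\<close>.\<close>
  have ker: "raag_ker K \<Gamma> \<chi> = lin_span K L (g ` ?X) \<inter> I"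
    using submoduleE(1)[OF span]
    by (auto simp: raag_ker_def raag_span_def I_def f_def a_kernel_def' ab_proj_closed
        simp flip: L_def g_def)
  have pos: "fin_gen_lie K L I \<and> lie_generated K L (raag_ker K \<Gamma> \<chi>) = I" if P: ?P
  proof -
    obtain t where t: "t \<in> lin_span K L (g ` ?X)"
      and tI: "lie_generated K L ((\<lambda>v. g v \<ominus>\<^bsub>L\<^esub> f (g v) \<odot>\<^bsub>L\<^esub> t) ` ?X) = I"
      using kernel_generated_of_connected_dominant[OF lie_character_axioms G.sym_digraph_axioms g gen comm]
        P unfolding sub I_def by blast
    let ?S = "(\<lambda>v. g v \<ominus>\<^bsub>L\<^esub> f (g v) \<odot>\<^bsub>L\<^esub> t) ` ?X"
    have "?S \<subseteq> I" using subset_lie_generated[of ?S K L] tI by simp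
    moreover have "?S \<subseteq> lin_span K L (g ` ?X)"
    proof
      fix x assume "x \<in> ?S"
      then obtain v where v: "v \<in> ?X" "x = g v \<ominus>\<^bsub>L\<^esub> f (g v) \<odot>\<^bsub>L\<^esub> t" by blast
      have "g v \<in> lin_span K L (g ` ?X)" using v(1) subset_lin_span by fastforce
      then show "x \<in> lin_span K L (g ` ?X)"
        using submoduleE(3-5)[OF span] t char_closed[OF g[OF v(1)]] by (simp add: v(2) a_minus_def)
    qed
    ultimately have "I \<subseteq> lie_generated K L (raag_ker K \<Gamma> \<chi>)"
      using lie_generated_mono[of ?S "raag_ker K \<Gamma> \<chi>" K L] tI by (simp add: ker)
    moreover have "lie_generated K L (raag_ker K \<Gamma> \<chi>) \<subseteq> I"
      using kernel_subalgebra by (intro lie_generated_subset) (auto simp: ker I_def)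
    ultimately show ?thesis
      using \<open>?S \<subseteq> I\<close> tI by (auto simp: fin_gen_lie_def intro!: exI[of _ ?S])
  qed
  have neg: "\<not> fin_gen_lie K L I" if nP: "\<not> ?P"
  proof -
    \<comment> \<open>Otherwise the kernel of \<open>f\<close>, a subalgebra, would contain all
      generators and hence be \<open>L\<close>, contradicting that \<chi> is nonzero.\<close>
    have "\<exists>v\<in>?X. f (g v) \<noteq> \<zero>\<^bsub>K\<^esub>"
    proof (rule ccontr)
      assume "\<not> ?thesis"
      then have "g ` ?X \<subseteq> {x \<in> carrier L. f x = \<zero>\<^bsub>K\<^esub>}" using g by auto
      from lie_generated_subset[OF kernel_subalgebra this] have "\<forall>x\<in>carrier L. f x = \<zero>\<^bsub>K\<^esub>"
        by (auto simp: gen)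
      then show False
        using assms(4) ab_proj_surj by (auto simp: f_def simp flip: L_def)
    qed
    then obtain v0 where "v0 \<in> ?X" "f (g v0) \<noteq> \<zero>\<^bsub>K\<^esub>" by blast
    from obstruction_of_not_connected_dominant[OF assms(1) G.sym_digraph_axioms,
        of "\<lambda>v. f (g v)", OF char_closed[OF g] this nP[unfolded sub]]
    obtain p v0 v1 where p: "\<And>v. v \<in> ?X \<Longrightarrow> p v \<in> carrier K"
      and eq: "\<And>v w. v \<rightarrow>\<^bsub>\<Gamma>\<^esub> w \<Longrightarrow> f (g v) \<otimes>\<^bsub>K\<^esub> p w = f (g w) \<otimes>\<^bsub>K\<^esub> p v"
      and v: "v0 \<in> ?X" "v1 \<in> ?X" "f (g v0) \<noteq> \<zero>\<^bsub>K\<^esub>"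
        "f (g v0) \<otimes>\<^bsub>K\<^esub> p v1 \<noteq> f (g v1) \<otimes>\<^bsub>K\<^esub> p v0"
      by blast
    \<comment> \<open>For a relator \<open>[v, w]\<close> only the coefficient at degree one could
      be nonzero, and it is the difference of the two sides of \<open>eq\<close>.\<close>
    have R: "term_char K (\<lambda>v. f (g v)) r = \<zero>\<^bsub>K\<^esub> \<and> (\<forall>n. term_coeff K (\<lambda>v. f (g v)) p r n = \<zero>\<^bsub>K\<^esub>)"
      if r: "r \<in> ?R" for r
    proof -
      obtain v w where r_eq: "r = Bracket (Gen v) (Gen w)" and vw: "v \<rightarrow>\<^bsub>\<Gamma>\<^esub> w"
        using r by (auto simp: raag_relators_def)
      have "v \<in> ?X" "w \<in> ?X" using G.adj_in_verts[OF vw] by auto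
      then show ?thesis
        using eq[OF vw] p char_closed[OF g]
        by (auto simp: r_eq a_minus_def K.r_neg split: nat.split)
    qed
    have "\<not> fin_gen_lie K (presented_lie K ?X ?R) {x \<in> carrier (presented_lie K ?X ?R). f x = \<zero>\<^bsub>K\<^esub>}"
    proof (rule presented_not_fin_gen)
      show "lie_character K (presented_lie K ?X ?R) f" using lie_character_axioms by (simp add: L)
      show "(\<lambda>v. f (g v)) = (\<lambda>v. f (lie_class K ?X ?R (Gen v)))" by (simp add: g_def raag_gen_def)
    qed (fact p R v)+
    then show ?thesis by (simp add: I_def L)
  qed
  show ?thesis
    using pos neg unfolding I[symmetric] L_def[symmetric] by blast
qed

end
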